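(* Any $m$-dimensional local tropical linear space $L(p)_B$ (where $p\in\mathbb{T}^{\binom{[n]}{m}}$ is a tropical Plücker vector of rank $m$ with underlying matroid $M$, and $B$ is a basis of $M$) is homeomorphic to $\mathbb{R}^m$. More specifically, if $B=\{b_1,\dots,b_m\}\subseteq[n]$, then the function $f_B:\mathbb{R}^m\to\mathbb{R}^n$ sending a vector $x=(x_1,\dots,x_m)\in\mathbb{R}^m$ to the vector $f_B(x)\in\mathbb{R}^n$ defined by \[ (f_B(x))_i := \begin{cases} x_j & \text{if } i=b_j \text{ for some } j,\\ \displaystyle\min_{b_j\in C(i,B)-i}\bigl(x_j+p_{B\cup i-b_j}-p_B\bigr) & \text{if } i\in[n]\setminus B,\end{cases} \] is a piecewise linear homeomorphism between $\mathbb{R}^m$ and $L(p)_B$.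
   Context: Notation: $m\le n$ are nonnegative integers; $[n]=\{1,\dots,n\}$; $\binom{[n]}{m}$ is the set of $m$-element subsets of $[n]$; $\mathbb{T}=\mathbb{R}\cup\{\infty\}$; for a set $S$ write $S\cup i$, $S-i$ for $S\cup\{i\}$, $S\setminus\{i\}$. Tropical Plücker vector of rank $m$: a vector $p\in\mathbb{T}^{\binom{[n]}{m}}$ such that for all $S,T\subseteq[n]$ with $|S|=m-1$, $|T|=m+1$, the minimum $\min_{i\in T\setminus S}(p_{S\cup i}+p_{T-i})$ is achieved for at least two values of $i$ or equals $\infty$. Its support $\{A : p_A\ne\infty\}$ is the set of bases of a matroid $M$ on $[n]$, the underlying matroid of $p$. For $S\subseteq[n]$ with $|S|=m+1$ let $c_S\in\mathbb{T}^n$ be given by $(c_S)_i=p_{S-i}$ if $i\in S$ and $(c_S)_i=\infty$ otherwise. The circuits of $p$ are the vectors $c_S+\lambda(1,\dots,1)$, $\lambda\in\mathbb{R}$, with $c_S\neq(\infty,\dots,\infty)$. Vectors $x,y\in\mathbb{T}^n$ are tropically orthogonal if $\min_i(x_i+y_i)$ is achieved at least twice or equals $\infty$. The tropical linear space $L(p)\subseteq\mathbb{T}^n$ is the set of vectors tropically orthogonal to all circuits of $p$. For a basis $A$ of $M$ and $v\in\mathbb{R}^n$, the $v$-weight of $A$ is $w_p(v,A)=-p_A+\sum_{i\in A}v_i$. The bases of $M$ of maximal $v$-weight are the bases of a matroid $M_v$ on $[n]$. For a basis $B$ of $M$, $\Sigma_B=\{v\in\mathbb{R}^n : B \text{ is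 a basis of } M_v\}$, and the local tropical linear space is $L(p)_B=L(p)\cap\Sigma_B\subseteq\mathbb{R}^n$. For $i\in[n]\setminus B$, $C(i,B)$ denotes the fundamental circuit of $i$ over $B$, the unique circuit of $M$ contained in $B\cup i$.
   Formalization: The underlying matroid M is additionally assumed to have no loops; if M has a loop i, then every vector of L(p) has i-th coordinate ∞, so L(p)_B is empty and the minimum defining (f_B(x))_i is over an empty set. *)

theory Defs
  imports "HOL-Analysis.Analysis"
begin

text \<open>
  The ground set is \<^term>\<open>{..<n}\<close> rather than \<open>{1, \<dots>, n}\<close>. This matches the library's
  \<^term>\<open>Euclidean_space n\<close>, whose points are the functions \<open>nat \<Rightarrow> real\<close> vanishing from
  index \<open>n\<close> on. The tropical numbers are the extended reals other than \<open>-\<infinity>\<close>.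
\<close>

definition trop_space :: "nat \<Rightarrow> (nat \<Rightarrow> ereal) set" where
  "trop_space n = {x. (\<forall>i<n. x i \<noteq> -\<infinity>) \<and> (\<forall>i\<ge>n. x i = 0)}"

text \<open>Used for finite \<open>I\<close> only; the infimum over the empty set is \<open>\<infinity>\<close>.\<close>

definition min_twice :: "'a set \<Rightarrow> ('a \<Rightarrow> ereal) \<Rightarrow> bool" where
  "min_twice I f \<longleftrightarrow>
     (INF k\<in>I. f k) = \<infinity> \<or>
     (\<exists>i\<in>I. \<exists>j\<in>I. i \<noteq> j \<and> f i = (INF k\<in>I. f k) \<and> f j = (INF k\<in>I. f k))"

text \<open>
  A vector indexed by the \<open>m\<close>-subsets of the ground set is a function on all sets, of which
  only the values at these \<open>m\<close>-subsets matter. Writing \<open>|S| = m - 1\<close> as \<open>card S + 1 = m\<close>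
  avoids truncated subtraction when \<open>m = 0\<close>.
\<close>

definition tropical_pluecker :: "nat \<Rightarrow> nat \<Rightarrow> (nat set \<Rightarrow> ereal) \<Rightarrow> bool" where
  "tropical_pluecker m n p \<longleftrightarrow>
     m \<le> n \<and>
     (\<forall>A. A \<subseteq> {..<n} \<and> card A = m \<longrightarrow> p A \<noteq> -\<infinity>) \<and>
     (\<forall>S T. S \<subseteq> {..<n} \<and> T \<subseteq> {..<n} \<and> card S + 1 = m \<and> card T = m + 1 \<longrightarrow>
        min_twice (T - S) (\<lambda>i. p (insert i S) + p (T - {i})))"

text \<open>Matroids on \<^term>\<open>{..<n}\<close> are given by their sets of bases.\<close>

definition underlying_bases :: "nat \<Rightarrow> nat \<Rightarrow> (nat set \<Rightarrow> ereal) \<Rightarrow> nat set set" where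
  "underlying_bases m n p = {A. A \<subseteq> {..<n} \<and> card A = m \<and> p A \<noteq> \<infinity>}"

definition matroid_indep :: "nat set set \<Rightarrow> nat set \<Rightarrow> bool" where
  "matroid_indep \<B> I \<longleftrightarrow> (\<exists>A\<in>\<B>. I \<subseteq> A)"

definition matroid_circuit :: "nat \<Rightarrow> nat set set \<Rightarrow> nat set \<Rightarrow> bool" where
  "matroid_circuit n \<B> C \<longleftrightarrow>
     C \<subseteq> {..<n} \<and> \<not> matroid_indep \<B> C \<and> (\<forall>D. D \<subset> C \<longrightarrow> matroid_indep \<B> D)"

definition loopless :: "nat \<Rightarrow> nat set set \<Rightarrow> bool" where
  "loopless n \<B> \<longleftrightarrow> (\<forall>i<n. matroid_indep \<B> {i})"

definition fundamental_circuit :: "nat \<Rightarrow> nat set set \<Rightarrow> nat \<Rightarrow> nat set \<Rightarrow> nat set" where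
  "fundamental_circuit n \<B> i B = (THE C. matroid_circuit n \<B> C \<and> C \<subseteq> insert i B)"

definition circuit_vector :: "nat \<Rightarrow> (nat set \<Rightarrow> ereal) \<Rightarrow> nat set \<Rightarrow> nat \<Rightarrow> ereal" where
  "circuit_vector n p S i = (if i \<in> S then p (S - {i}) else if i < n then \<infinity> else 0)"

definition valuated_circuits :: "nat \<Rightarrow> nat \<Rightarrow> (nat set \<Rightarrow> ereal) \<Rightarrow> (nat \<Rightarrow> ereal) set" where
  "valuated_circuits m n p =
     {(\<lambda>i. if i < n then circuit_vector n p S i + ereal t else 0) | S t.
        S \<subseteq> {..<n} \<and> card S = m + 1 \<and> (\<exists>i<n. circuit_vector n p S i \<noteq> \<infinity>)}"

definition tropically_orthogonal :: "nat \<Rightarrow> (nat \<Rightarrow> ereal) \<Rightarrow> (nat \<Rightarrow> ereal) \<Rightarrow> bool" where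
  "tropically_orthogonal n x y \<longleftrightarrow> min_twice {..<n} (\<lambda>i. x i + y i)"

definition tropical_linear_space ::
  "nat \<Rightarrow> nat \<Rightarrow> (nat set \<Rightarrow> ereal) \<Rightarrow> (nat \<Rightarrow> ereal) set" where
  "tropical_linear_space m n p =
     {x \<in> trop_space n. \<forall>c\<in>valuated_circuits m n p. tropically_orthogonal n x c}"

definition basis_weight :: "(nat set \<Rightarrow> ereal) \<Rightarrow> (nat \<Rightarrow> real) \<Rightarrow> nat set \<Rightarrow> ereal" where
  "basis_weight p v A = - p A + ereal (\<Sum>i\<in>A. v i)"

text \<open>The set of bases of the matroid \<open>M\<^sub>v\<close>.\<close>

definition max_weight_bases ::
  "nat \<Rightarrow> nat \<Rightarrow> (nat set \<Rightarrow> ereal) \<Rightarrow> (nat \<Rightarrow> real) \<Rightarrow> nat set set" where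
  "max_weight_bases m n p v =
     {A \<in> underlying_bases m n p.
        \<forall>A'\<in>underlying_bases m n p. basis_weight p v A' \<le> basis_weight p v A}"

definition basis_cell :: "nat \<Rightarrow> nat \<Rightarrow> (nat set \<Rightarrow> ereal) \<Rightarrow> nat set \<Rightarrow> (nat \<Rightarrow> real) set" where
  "basis_cell m n p B =
     {v \<in> topspace (Euclidean_space n). B \<in> max_weight_bases m n p v}"

definition local_tropical_linear_space ::
  "nat \<Rightarrow> nat \<Rightarrow> (nat set \<Rightarrow> ereal) \<Rightarrow> nat set \<Rightarrow> (nat \<Rightarrow> real) set" where
  "local_tropical_linear_space m n p B =
     {v \<in> basis_cell m n p B. (\<lambda>i. ereal (v i)) \<in> tropical_linear_space m n p}"

text \<open>
  The map \<open>f\<^sub>B\<close>, for a basis \<open>B\<close> enumerated as \<open>b 0, \<dots>, b (m - 1)\<close>. The set under \<open>Min\<close> is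
  nonempty exactly if \<open>i\<close> is not a loop, and the values of \<open>p\<close> used there are finite.
\<close>

definition local_param ::
  "nat \<Rightarrow> nat \<Rightarrow> (nat set \<Rightarrow> ereal) \<Rightarrow> nat set \<Rightarrow> (nat \<Rightarrow> nat) \<Rightarrow> (nat \<Rightarrow> real) \<Rightarrow> nat \<Rightarrow> real" where
  "local_param m n p B b x i =
     (if i \<in> B then x (the_inv_into {..<m} b i)
      else if i < n then
        Min ((\<lambda>j. x j + real_of_ereal (p (insert i B - {b j})) - real_of_ereal (p B)) `
             {j. j < m \<and> b j \<in> fundamental_circuit n (underlying_bases m n p) i B - {i}})
      else 0)"

definition polyhedron_in :: "nat \<Rightarrow> (nat \<Rightarrow> real) set \<Rightarrow> bool" where
  "polyhedron_in k P \<longleftrightarrow>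
     (\<exists>F :: ((nat \<Rightarrow> real) \<times> real) set. finite F \<and>
        P = {x \<in> topspace (Euclidean_space k). \<forall>(a, c)\<in>F. (\<Sum>i<k. a i * x i) \<le> c})"

definition affine_map_on ::
  "nat \<Rightarrow> nat \<Rightarrow> (nat \<Rightarrow> real) set \<Rightarrow> ((nat \<Rightarrow> real) \<Rightarrow> (nat \<Rightarrow> real)) \<Rightarrow> bool" where
  "affine_map_on k l P f \<longleftrightarrow>
     (\<exists>(A :: nat \<Rightarrow> nat \<Rightarrow> real) d. \<forall>x\<in>P. \<forall>i<l. f x i = (\<Sum>j<k. A i j * x j) + d i)"

definition piecewise_linear_on ::
  "nat \<Rightarrow> nat \<Rightarrow> (nat \<Rightarrow> real) set \<Rightarrow> ((nat \<Rightarrow> real) \<Rightarrow> (nat \<Rightarrow> real)) \<Rightarrow> bool" where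
  "piecewise_linear_on k l X f \<longleftrightarrow>
     (\<exists>\<P>. finite \<P> \<and> \<Union>\<P> = X \<and> (\<forall>P\<in>\<P>. polyhedron_in k P \<and> affine_map_on k l P f))"

definition piecewise_linear_homeomorphism ::
  "nat \<Rightarrow> nat \<Rightarrow> (nat \<Rightarrow> real) set \<Rightarrow> (nat \<Rightarrow> real) set \<Rightarrow>
   ((nat \<Rightarrow> real) \<Rightarrow> (nat \<Rightarrow> real)) \<Rightarrow> bool" where
  "piecewise_linear_homeomorphism k l X Y f \<longleftrightarrow>
     X \<subseteq> topspace (Euclidean_space k) \<and> Y \<subseteq> topspace (Euclidean_space l) \<and>
     (\<exists>g. homeomorphic_maps (subtopology (Euclidean_space k) X)
                            (subtopology (Euclidean_space l) Y) f g \<and>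
          piecewise_linear_on k l X f \<and> piecewise_linear_on l k Y g)"

end

theory Submission
  imports Defs
begin

text \<open>
  Write \<open>w\<close> for the real-valued restriction of \<open>p\<close> to the bases, and let \<open>v \<in> \<real>\<^sup>n\<close>. Subtracting
  \<open>\<Sum>i\<in>A. v i\<close> from \<open>w A\<close> changes both sides of every exchange inequality by the same amount,
  so \<open>u A = w A - (\<Sum>i\<in>A. v i)\<close> is again a valuated matroid. Both conditions that define
  \<open>L(p)\<^sub>B\<close> can be read off \<open>u\<close>, and both need to be checked on the neighbours \<open>B \<union> i - k\<close> of \<open>B\<close> only.

  The basis \<open>B\<close> has maximal \<open>v\<close>-weight iff it minimizes \<open>u\<close>. A local minimum of a valuated matroid is
  a global minimum (\<open>local_min_imp_global_min\<close>), so this amounts to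
  \<open>v i \<le> v k + (w (B \<union> i - k) - w B)\<close> for every \<open>i \<notin> B\<close> and every neighbour \<open>B \<union> i - k\<close>.

  The vector \<open>v\<close> is orthogonal to all circuits iff no circuit attains its minimum only once.
  When \<open>B\<close> minimizes \<open>u\<close>, this means that every \<open>i \<notin> B\<close> has a neighbour \<open>B \<union> i - k\<close> that
  minimizes \<open>u\<close> as well, i.e. that the matroid of \<open>u\<close>-minimal bases has no loops
  (\<open>no_unique_circuit_min_iff\<close>); then one of the inequalities above is an equality.

  The two conditions together say that \<open>v i = min\<^sub>k (v k + (w (B \<union> i - k) - w B))\<close> for all \<open>i \<notin> B\<close>, where
  \<open>k\<close> runs through \<open>C(i,B) - i\<close>. Hence \<open>L(p)\<^sub>B\<close> is the graph of a map given by minima of affine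
  functions of the coordinates in \<open>B\<close>. The map \<open>f\<^sub>B\<close> parametrizes this graph, and the projection to the
  coordinates in \<open>B\<close> is its inverse. Both maps are continuous, and choosing for every \<open>i \<notin> B\<close> an
  index at which the minimum is attained cuts the two sides into finitely many polyhedra on which the
  maps are affine (\<open>piecewise_linear_homeomorphism_min_graph\<close>).
\<close>

section \<open>Valuated matroids\<close>

text \<open>
  The tropical Pluecker relations enter the argument only through this symmetric exchange property.
  It only mentions values at bases, which is why \<open>w\<close> is real-valued.
\<close>

locale valuated_matroid =
  fixes \<B> :: "'a set set" and w :: "'a set \<Rightarrow> real"
  assumes finite_basis: "A \<in> \<B> \<Longrightarrow> finite A"
    and exchange: "\<lbrakk>A \<in> \<B>; B \<in> \<B>; i \<in> A - B\<rbrakk> \<Longrightarrow>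
      \<exists>k \<in> B - A. insert k A - {i} \<in> \<B> \<and> insert i B - {k} \<in> \<B>
        \<and> w (insert k A - {i}) + w (insert i B - {k}) \<le> w A + w B"
begin

text \<open>
  Exchanging an element of \<open>B - A\<close> requires an element of \<open>A - B\<close> to replace it.
\<close>

lemma basis_not_psubset:
  assumes "A \<in> \<B>" "B \<in> \<B>" "A \<subseteq> B"
  shows "A = B"
proof (rule ccontr)
  assume "A \<noteq> B"
  with assms obtain i where "i \<in> B - A" by blast
  from exchange[OF assms(2,1) this] assms(3) show False by blast
qed

text \<open>
  An exchange moves \<open>i\<close> and \<open>k\<close> between the two bases, which leaves the sum of the two \<open>v\<close>-weights
  unchanged.
\<close>

lemma tilted:
  "valuated_matroid \<B> (\<lambda>A. w A - (\<Sum>i\<in>A. v i))"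
proof
  fix A B i assume A: "A \<in> \<B>" and B: "B \<in> \<B>" and i: "i \<in> A - B"
  from exchange[OF A B i] obtain k where k: "k \<in> B - A" "insert k A - {i} \<in> \<B>"
      "insert i B - {k} \<in> \<B>" "w (insert k A - {i}) + w (insert i B - {k}) \<le> w A + w B"
    by blast
  have "(\<Sum>j\<in>insert k A - {i}. v j) = (\<Sum>j\<in>A. v j) + v k - v i"
    using k i finite_basis[OF A] by (simp add: sum_diff1)
  moreover have "(\<Sum>j\<in>insert i B - {k}. v j) = (\<Sum>j\<in>B. v j) + v i - v k"
    using k i finite_basis[OF B] by (simp add: sum_diff1)
  ultimately show "\<exists>k\<in>B - A. insert k A - {i} \<in> \<B> \<and> insert i B - {k} \<in> \<B> \<and>
      w (insert k A - {i}) - (\<Sum>i\<in>insert k A - {i}. v i)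
        + (w (insert i B - {k}) - (\<Sum>i\<in>insert i B - {k}. v i))
      \<le> w A - (\<Sum>i\<in>A. v i) + (w B - (\<Sum>i\<in>B. v i))"
    using k by (intro bexI[of _ k]) auto
qed (rule finite_basis)

text \<open>
  The exchange between \<open>A\<close> and \<open>B\<close> at \<open>i \<in> A - B\<close> replaces \<open>B\<close> by a neighbour, whose value is
  at least \<open>w B\<close>; it therefore cannot increase the value of \<open>A\<close>. As it also brings \<open>A\<close> closer
  to \<open>B\<close>, induction on \<open>card (A - B)\<close> applies.
\<close>

lemma local_min_imp_global_min:
  assumes B: "B \<in> \<B>"
    and loc: "\<And>i k. \<lbrakk>i \<notin> B; k \<in> B; insert i B - {k} \<in> \<B>\<rbrakk> \<Longrightarrow> w B \<le> w (insert i B - {k})"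
    and A: "A \<in> \<B>"
  shows "w B \<le> w A"
  using A
proof (induction "card (A - B)" arbitrary: A rule: less_induct)
  case less
  show ?case
  proof (cases "A \<subseteq> B")
    case True
    with less.prems B basis_not_psubset show ?thesis by blast
  next
    case False
    then obtain i where i: "i \<in> A - B" by blast
    from exchange[OF less.prems B i] obtain k where k: "k \<in> B - A" "insert k A - {i} \<in> \<B>"
      "insert i B - {k} \<in> \<B>" "w (insert k A - {i}) + w (insert i B - {k}) \<le> w A + w B"
      by blast
    have "insert k A - {i} - B = (A - B) - {i}" using k i by blast
    then have "card (insert k A - {i} - B) < card (A - B)"
      using card_Diff1_less[OF finite_Diff[OF finite_basis[OF less.prems]] i] by simp
    then have "w B \<le> w (insert k A - {i})" using less.hyps k(2) by blast
    moreover have "w B \<le> w (insert i B - {k})" using loc i k by blast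
    ultimately show ?thesis using k(4) by linarith
  qed
qed

text \<open>
  The left-hand side says that no circuit \<open>c\<^sub>S\<close> with \<open>S = A \<union> i\<close> has its minimum at \<open>i\<close> only;
  the right-hand side says that every \<open>i \<in> E\<close> lies in a basis \<open>D\<close> of minimal value. Given such
  a \<open>D\<close>, exchange \<open>i \<in> D - A\<close> for some \<open>k \<in> A - D\<close>: the value of \<open>D\<close> cannot decrease, so that of
  \<open>A\<close> does not increase, and \<open>k\<close> is a second index at which \<open>c\<^sub>S\<close> is no larger than at \<open>i\<close>.
\<close>

lemma no_unique_circuit_min_iff:
  assumes B: "B \<in> \<B>" and minB: "\<And>A. A \<in> \<B> \<Longrightarrow> w B \<le> w A"
  shows "(\<forall>A\<in>\<B>. \<forall>i\<in>E - A. \<exists>j\<in>A. insert i A - {j} \<in> \<B> \<and> w (insert i A - {j}) \<le> w A) \<longleftrightarrow>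
         (\<forall>i\<in>E - B. \<exists>j\<in>B. insert i B - {j} \<in> \<B> \<and> w (insert i B - {j}) \<le> w B)"
    (is "?L \<longleftrightarrow> ?R")
proof
  assume ?L with B show ?R by blast
next
  assume R: ?R
  show ?L
  proof (intro ballI)
    fix A i assume A: "A \<in> \<B>" and i: "i \<in> E - A"
    obtain D where D: "D \<in> \<B>" "i \<in> D" "w D \<le> w B"
    proof (cases "i \<in> B")
      case True
      with B show ?thesis by (intro that) auto
    next
      case False
      with R i obtain j where "j \<in> B" "insert i B - {j} \<in> \<B>" "w (insert i B - {j}) \<le> w B"
        by blast
      with False show ?thesis by (intro that) auto
    qed
    from exchange[OF D(1) A, of i] D i obtain k where k: "k \<in> A - D" "insert k D - {i} \<in> \<B>"
      "insert i A - {k} \<in> \<B>" "w (insert k D - {i}) + w (insert i A - {k}) \<le> w D + w A"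
      by blast
    have "w D \<le> w (insert k D - {i})" using minB[OF k(2)] D(3) by linarith
    with k show "\<exists>j\<in>A. insert i A - {j} \<in> \<B> \<and> w (insert i A - {j}) \<le> w A"
      by (intro bexI[of _ k]) auto
  qed
qed

text \<open>
  For \<open>i \<notin> B\<close> the set of all \<open>k\<close> with \<open>B \<union> i - k\<close> a basis will turn out to be the fundamental circuit.
  It is dependent: if a basis \<open>A\<close> contained it, then \<open>A\<close> would contain \<open>i\<close>, and the exchange of \<open>i\<close>
  with \<open>B\<close> would produce a further element of this set outside \<open>A\<close>.
\<close>

lemma exchange_set_indep_iff:
  assumes B: "B \<in> \<B>"
  shows "(\<exists>A\<in>\<B>. {k \<in> insert i B. insert i B - {k} \<in> \<B>} \<subseteq> A) \<longleftrightarrow> i \<in> B"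
proof
  assume "\<exists>A\<in>\<B>. {k \<in> insert i B. insert i B - {k} \<in> \<B>} \<subseteq> A"
  then obtain A where A: "A \<in> \<B>" "{k \<in> insert i B. insert i B - {k} \<in> \<B>} \<subseteq> A" by blast
  show "i \<in> B"
  proof (rule ccontr)
    assume i: "i \<notin> B"
    then have "insert i B - {i} \<in> \<B>" using B by simp
    with A have "i \<in> A" by blast
    with exchange[OF A(1) B, of i] i obtain k where "k \<in> B - A" "insert i B - {k} \<in> \<B>"
      by blast
    with A show False by blast
  qed
next
  assume "i \<in> B"
  with B show "\<exists>A\<in>\<B>. {k \<in> insert i B. insert i B - {k} \<in> \<B>} \<subseteq> A"
    by (intro bexI[of _ B]) auto
qed

end

text \<open>
  A subset of \<open>B \<union> i\<close> that misses some \<open>k\<close> in the set on the right lies in the basis \<open>B \<union> i - k\<close>.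
  So this set is contained in every dependent subset of \<open>B \<union> i\<close>; being dependent itself, it is the
  only circuit there.
\<close>

lemma fundamental_circuit_eq:
  assumes vm: "valuated_matroid \<B> w" and B: "B \<in> \<B>" "B \<subseteq> {..<n}" and i: "i < n" "i \<notin> B"
  shows "fundamental_circuit n \<B> i B = {k \<in> insert i B. insert i B - {k} \<in> \<B>}" (is "_ = ?C")
proof -
  interpret valuated_matroid \<B> w by fact
  have dep: "\<not> matroid_indep \<B> ?C"
    using exchange_set_indep_iff[OF B(1), of i] i unfolding matroid_indep_def by blast
  have ind: "matroid_indep \<B> D" if "D \<subseteq> insert i B" "k \<in> ?C - D" for D k
    using that unfolding matroid_indep_def by (intro bexI[of _ "insert i B - {k}"]) auto
  show ?thesis
    unfolding fundamental_circuit_def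
  proof (rule the_equality)
    show "matroid_circuit n \<B> ?C \<and> ?C \<subseteq> insert i B"
      unfolding matroid_circuit_def
    proof (intro conjI allI impI dep)
      show "?C \<subseteq> {..<n}" using B i by auto
      show "?C \<subseteq> insert i B" by blast
      fix D assume D: "D \<subset> ?C"
      then obtain k where "k \<in> ?C - D" by blast
      with D show "matroid_indep \<B> D" by (intro ind) blast+
    qed
  next
    fix C assume C: "matroid_circuit n \<B> C \<and> C \<subseteq> insert i B"
    then have "\<not> matroid_indep \<B> C" unfolding matroid_circuit_def by blast
    with C ind[of C] have "?C \<subseteq> C" by blast
    moreover have "\<not> ?C \<subset> C" using C dep unfolding matroid_circuit_def by blast
    ultimately show "C = ?C" by blast
  qed
qed

section \<open>Tropical linear spaces\<close>

text \<open>
  This form does not mention the minimum: it requires every value other than \<open>\<infinity>\<close> to be matched or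
  undercut at another index. Exchange properties can be read off it directly.
\<close>

lemma min_twice_iff:
  assumes "finite I"
  shows "min_twice I f \<longleftrightarrow> (\<forall>i\<in>I. f i \<noteq> \<infinity> \<longrightarrow> (\<exists>j\<in>I. j \<noteq> i \<and> f j \<le> f i))" (is "_ \<longleftrightarrow> ?R")
proof
  assume mt: "min_twice I f"
  show ?R
  proof (intro ballI impI)
    fix i assume i: "i \<in> I" "f i \<noteq> \<infinity>"
    have le: "(INF k\<in>I. f k) \<le> f i" using i by (intro INF_lower)
    with i have "(INF k\<in>I. f k) \<noteq> \<infinity>" by auto
    with mt obtain j k where "j \<in> I" "k \<in> I" "j \<noteq> k"
        "f j = (INF k\<in>I. f k)" "f k = (INF k\<in>I. f k)"
      unfolding min_twice_def by blast
    with le show "\<exists>j\<in>I. j \<noteq> i \<and> f j \<le> f i" by (cases "j = i") auto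
  qed
next
  assume R: ?R
  show "min_twice I f"
  proof (cases "(INF k\<in>I. f k) = \<infinity>")
    case True
    then show ?thesis by (simp add: min_twice_def)
  next
    case False
    then have ne: "I \<noteq> {}" by (auto simp: top_ereal_def)
    then have "(INF k\<in>I. f k) = Min (f ` I)" using assms by (subst Min_Inf) auto
    moreover have "Min (f ` I) \<in> f ` I" using assms ne by (intro Min_in) auto
    ultimately obtain i where i: "i \<in> I" "f i = (INF k\<in>I. f k)" by auto
    with R False obtain j where j: "j \<in> I" "j \<noteq> i" "f j \<le> f i" by auto
    moreover have "(INF k\<in>I. f k) \<le> f j" using j by (intro INF_lower)
    ultimately have "f j = (INF k\<in>I. f k)" using i by auto
    with i j show ?thesis unfolding min_twice_def by metis
  qed
qed

lemma basis_finite_value: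
  assumes "tropical_pluecker m n p" "A \<in> underlying_bases m n p"
  shows "p A = ereal (real_of_ereal (p A))"
  using assms by (cases "p A") (auto simp: tropical_pluecker_def underlying_bases_def)

lemma basis_replace:
  assumes "tropical_pluecker m n p" "A \<in> underlying_bases m n p"
    "i < n" "i \<notin> A" "j \<in> insert i A" "p (insert i A - {j}) \<noteq> \<infinity>"
  shows "insert i A - {j} \<in> underlying_bases m n p"
proof -
  have "finite A" using assms finite_subset[of A "{..<n}"] by (auto simp: underlying_bases_def)
  with assms show ?thesis by (auto simp: underlying_bases_def)
qed

text \<open>
  The Pluecker relation for \<open>S = A - i\<close> and \<open>T = B \<union> i\<close> has the term \<open>p A + p B\<close> at the index \<open>i\<close>.
  This term is finite, so there is another index whose term is at most as large.
\<close>

lemma pluecker_valuated_matroid: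
  assumes tp: "tropical_pluecker m n p"
  shows "valuated_matroid (underlying_bases m n p) (\<lambda>A. real_of_ereal (p A))"
proof
  fix A assume "A \<in> underlying_bases m n p"
  then show "finite A" using finite_subset by (auto simp: underlying_bases_def)
next
  fix A B i
  assume A: "A \<in> underlying_bases m n p" and B: "B \<in> underlying_bases m n p" and i: "i \<in> A - B"
  have fin: "finite A" "finite B" and sub: "A \<subseteq> {..<n}" "B \<subseteq> {..<n}"
    and card: "card A = m" "card B = m"
    using A B finite_subset by (auto simp: underlying_bases_def)
  define S T where "S = A - {i}" and "T = insert i B"
  have "S \<subseteq> {..<n}" "T \<subseteq> {..<n}" "card S + 1 = m" "card T = m + 1"
    using i sub card fin card_Suc_Diff1[of A i] by (auto simp: S_def T_def)
  then have mt: "min_twice (T - S) (\<lambda>k. p (insert k S) + p (T - {k}))"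
    using tp unfolding tropical_pluecker_def by blast
  have fin: "finite (T - S)" using fin by (simp add: T_def)
  have "p A + p B = ereal (real_of_ereal (p A) + real_of_ereal (p B))"
    by (subst basis_finite_value[OF tp A], subst basis_finite_value[OF tp B]) simp
  moreover have "i \<in> T - S" "insert i S = A" "T - {i} = B" using i by (auto simp: S_def T_def)
  ultimately obtain k where k: "k \<in> T - S" "k \<noteq> i"
      "p (insert k S) + p (T - {k}) \<le> ereal (real_of_ereal (p A) + real_of_ereal (p B))"
    using bspec[OF iffD1[OF min_twice_iff[OF fin] mt], of i] by auto
  have kBA: "k \<in> B - A" using k by (auto simp: S_def T_def)
  have eq: "insert k S = insert k A - {i}" "T - {k} = insert i B - {k}"
    using k by (auto simp: S_def T_def)
  have "p (insert k S) \<noteq> \<infinity>" "p (T - {k}) \<noteq> \<infinity>" using k(3) by auto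
  then have bases: "insert k A - {i} \<in> underlying_bases m n p" 
      "insert i B - {k} \<in> underlying_bases m n p"
    using basis_replace[OF tp A, of k i] basis_replace[OF tp B, of i k] i kBA sub
    by (auto simp: eq)
  have "real_of_ereal (p (insert k A - {i})) + real_of_ereal (p (insert i B - {k}))
      \<le> real_of_ereal (p A) + real_of_ereal (p B)"
    using k(3) basis_finite_value[OF tp bases(1)] basis_finite_value[OF tp bases(2)]
    unfolding eq by (metis ereal_less_eq(3) plus_ereal.simps(1))
  with kBA bases show "\<exists>k\<in>B - A. insert k A - {i} \<in> underlying_bases m n p \<and>
      insert i B - {k} \<in> underlying_bases m n p \<and>
      real_of_ereal (p (insert k A - {i})) + real_of_ereal (p (insert i B - {k}))
        \<le> real_of_ereal (p A) + real_of_ereal (p B)"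
    by blast
qed

abbreviation tilted_value :: "(nat set \<Rightarrow> ereal) \<Rightarrow> (nat \<Rightarrow> real) \<Rightarrow> nat set \<Rightarrow> real" where
  "tilted_value p v A \<equiv> real_of_ereal (p A) - (\<Sum>i\<in>A. v i)"

lemma max_weight_bases_iff:
  assumes tp: "tropical_pluecker m n p" and B: "B \<in> underlying_bases m n p"
  shows "B \<in> max_weight_bases m n p v \<longleftrightarrow>
    (\<forall>A\<in>underlying_bases m n p. tilted_value p v B \<le> tilted_value p v A)"
proof -
  have "basis_weight p v A = ereal (- tilted_value p v A)" if "A \<in> underlying_bases m n p" for A
    unfolding basis_weight_def by (subst basis_finite_value[OF tp that]) simp
  then show ?thesis using B by (auto simp: max_weight_bases_def)
qed

text \<open>
  Adding a constant to a circuit does not affect orthogonality, and indices outside \<open>S\<close> only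
  contribute the value \<open>\<infinity>\<close>.
\<close>

lemma orthogonal_circuit_iff:
  assumes S: "S \<subseteq> {..<n}"
  shows "tropically_orthogonal n (\<lambda>i. ereal (v i))
      (\<lambda>i. if i < n then circuit_vector n p S i + ereal t else 0) \<longleftrightarrow>
    (\<forall>i\<in>S. p (S - {i}) \<noteq> \<infinity> \<longrightarrow>
       (\<exists>j\<in>S. j \<noteq> i \<and> ereal (v j) + p (S - {j}) \<le> ereal (v i) + p (S - {i})))"
proof -
  define f where "f = (\<lambda>i. ereal (v i) + (if i < n then circuit_vector n p S i + ereal t else 0))"
  have f_in: "f i = ereal (v i) + p (S - {i}) + ereal t" if "i \<in> S" for i
    using that S by (auto simp: f_def circuit_vector_def add.assoc)
  have f_out: "f i = \<infinity>" if "i < n" "i \<notin> S" for i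
    using that by (simp add: f_def circuit_vector_def)
  have "tropically_orthogonal n (\<lambda>i. ereal (v i))
      (\<lambda>i. if i < n then circuit_vector n p S i + ereal t else 0) \<longleftrightarrow>
    (\<forall>i<n. f i \<noteq> \<infinity> \<longrightarrow> (\<exists>j<n. j \<noteq> i \<and> f j \<le> f i))"
    unfolding tropically_orthogonal_def f_def[symmetric] by (subst min_twice_iff) auto
  also have "\<dots> \<longleftrightarrow> (\<forall>i\<in>S. f i \<noteq> \<infinity> \<longrightarrow> (\<exists>j\<in>S. j \<noteq> i \<and> f j \<le> f i))"
    using f_out S by (metis ereal_infty_less_eq(1) lessThan_iff subsetD)
  also have "\<dots> \<longleftrightarrow> (\<forall>i\<in>S. p (S - {i}) \<noteq> \<infinity> \<longrightarrow>
       (\<exists>j\<in>S. j \<noteq> i \<and> ereal (v j) + p (S - {j}) \<le> ereal (v i) + p (S - {i})))"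
    by (auto simp: f_in ereal_add_le_add_iff2)
  finally show ?thesis .
qed

text \<open>
  A pair of a set \<open>S\<close> and an index \<open>i \<in> S\<close> at which \<open>c\<^sub>S\<close> is finite is the same as a basis
  \<open>A = S - i\<close> and an element \<open>i \<notin> A\<close>. Up to the constant \<open>\<Sum>k\<in>S. v k\<close>, the term of \<open>v\<close> and \<open>c\<^sub>S\<close> at
  \<open>j \<in> S\<close> is the tilted value of \<open>S - j\<close>.
\<close>

lemma mem_tropical_linear_space_iff:
  assumes tp: "tropical_pluecker m n p" and v: "v \<in> topspace (Euclidean_space n)"
  shows "(\<lambda>i. ereal (v i)) \<in> tropical_linear_space m n p \<longleftrightarrow>
    (\<forall>A\<in>underlying_bases m n p. \<forall>i\<in>{..<n} - A. \<exists>j\<in>A. insert i A - {j} \<in> underlying_bases m n p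
       \<and> tilted_value p v (insert i A - {j}) \<le> tilted_value p v A)" (is "_ \<longleftrightarrow> ?R")
proof -
  let ?orth = "\<lambda>S. \<forall>i\<in>S. p (S - {i}) \<noteq> \<infinity> \<longrightarrow>
       (\<exists>j\<in>S. j \<noteq> i \<and> ereal (v j) + p (S - {j}) \<le> ereal (v i) + p (S - {i}))"
  have "(\<lambda>i. ereal (v i)) \<in> trop_space n"
    using v by (simp add: trop_space_def topspace_Euclidean_space)
  then have "(\<lambda>i. ereal (v i)) \<in> tropical_linear_space m n p \<longleftrightarrow>
      (\<forall>S t. S \<subseteq> {..<n} \<and> card S = m + 1 \<and> (\<exists>i<n. circuit_vector n p S i \<noteq> \<infinity>) \<longrightarrow>
         tropically_orthogonal n (\<lambda>i. ereal (v i))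
           (\<lambda>i. if i < n then circuit_vector n p S i + ereal t else 0))"
    unfolding tropical_linear_space_def valuated_circuits_def mem_Collect_eq Ball_def by auto
  also have "\<dots> \<longleftrightarrow> (\<forall>S. S \<subseteq> {..<n} \<and> card S = m + 1
      \<and> (\<exists>i<n. circuit_vector n p S i \<noteq> \<infinity>) \<longrightarrow> ?orth S)"
    by (simp add: orthogonal_circuit_iff cong: conj_cong imp_cong)
  also have "\<dots> \<longleftrightarrow> (\<forall>S. S \<subseteq> {..<n} \<and> card S = m + 1 \<longrightarrow> ?orth S)"
  proof -
    have "\<exists>i<n. circuit_vector n p S i \<noteq> \<infinity>" if "S \<subseteq> {..<n}" "i \<in> S" "p (S - {i}) \<noteq> \<infinity>" for S i
      using that by (auto simp: circuit_vector_def)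
    then show ?thesis by (intro all_cong1) meson
  qed
  also have "\<dots> \<longleftrightarrow> ?R"
  proof -
    have tilt: "ereal (v j) + p (insert i A - {j}) \<le> ereal (v i) + p A \<longleftrightarrow>
        insert i A - {j} \<in> underlying_bases m n p
       \<and> tilted_value p v (insert i A - {j}) \<le> tilted_value p v A"
      if A: "A \<in> underlying_bases m n p" and i: "i \<in> {..<n} - A" and j: "j \<in> A" for A i j
    proof (cases "insert i A - {j} \<in> underlying_bases m n p")
      case True
      have "finite A" using A finite_subset by (auto simp: underlying_bases_def)
      then have sum: "(\<Sum>k\<in>insert i A - {j}. v k) = (\<Sum>k\<in>A. v k) + v i - v j"
        using i j by (simp add: sum_diff1)
      have "ereal (v j) + p (insert i A - {j})
          = ereal (v j + real_of_ereal (p (insert i A - {j})))"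
        by (subst basis_finite_value[OF tp True]) simp
      moreover have "ereal (v i) + p A = ereal (v i + real_of_ereal (p A))"
        by (subst basis_finite_value[OF tp A]) simp
      ultimately show ?thesis using True sum by auto
    next
      case False
      then have "p (insert i A - {j}) = \<infinity>" using basis_replace[OF tp A] i j by blast
      moreover have "p A \<noteq> \<infinity>" using A by (simp add: underlying_bases_def)
      ultimately show ?thesis using False by auto
    qed
    show ?thesis
    proof (intro iffI ballI allI impI)
      fix A i assume L: "\<forall>S. S \<subseteq> {..<n} \<and> card S = m + 1 \<longrightarrow> ?orth S"
        and A: "A \<in> underlying_bases m n p" and i: "i \<in> {..<n} - A"
      have "insert i A - {i} = A" using i by blast
      moreover have "insert i A \<subseteq> {..<n}" "card (insert i A) = m + 1" "p A \<noteq> \<infinity>"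
        using A i finite_subset[of A "{..<n}"] by (auto simp: underlying_bases_def)
      ultimately obtain j where "j \<in> insert i A" "j \<noteq> i"
          "ereal (v j) + p (insert i A - {j}) \<le> ereal (v i) + p A"
        using L by (metis insertI1)
      then show "\<exists>j\<in>A. insert i A - {j} \<in> underlying_bases m n p
           \<and> tilted_value p v (insert i A - {j}) \<le> tilted_value p v A"
        using tilt[OF A i, of j] by blast
    next
      fix S i assume R: ?R and S: "S \<subseteq> {..<n} \<and> card S = m + 1" and i: "i \<in> S"
        and fin: "p (S - {i}) \<noteq> \<infinity>"
      have "finite S" using S finite_subset by blast
      then have A: "S - {i} \<in> underlying_bases m n p"
        using S i fin by (auto simp: underlying_bases_def)
      have iA: "i \<in> {..<n} - (S - {i})" "insert i (S - {i}) = S" using S i by auto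
      obtain j where j: "j \<in> S - {i}" "insert i (S - {i}) - {j} \<in> underlying_bases m n p"
          "tilted_value p v (insert i (S - {i}) - {j}) \<le> tilted_value p v (S - {i})"
        using R A iA(1) by blast
      then have "ereal (v j) + p (S - {j}) \<le> ereal (v i) + p (S - {i})"
        using tilt[OF A iA(1) j(1)] by (simp only: iA(2) simp_thms)
      with j(1) show "\<exists>j\<in>S. j \<noteq> i \<and> ereal (v j) + p (S - {j}) \<le> ereal (v i) + p (S - {i})"
        by blast
    qed
  qed
  finally show ?thesis .
qed

text \<open>
  The upper bounds on \<open>v i\<close> express that \<open>B\<close> has maximal weight, and their being attained expresses,
  given the bounds, that \<open>v\<close> is orthogonal to all circuits.
\<close>

lemma local_tropical_linear_space_iff:
  assumes tp: "tropical_pluecker m n p" and B: "B \<in> underlying_bases m n p"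
  shows "v \<in> local_tropical_linear_space m n p B \<longleftrightarrow>
    v \<in> topspace (Euclidean_space n) \<and>
    (\<forall>i\<in>{..<n} - B.
       (\<forall>k\<in>B. insert i B - {k} \<in> underlying_bases m n p \<longrightarrow>
          v i \<le> v k + (real_of_ereal (p (insert i B - {k})) - real_of_ereal (p B))) \<and>
       (\<exists>k\<in>B. insert i B - {k} \<in> underlying_bases m n p \<and>
          v k + (real_of_ereal (p (insert i B - {k})) - real_of_ereal (p B)) \<le> v i))"
    (is "_ \<longleftrightarrow> _ \<and> (\<forall>i\<in>_. (\<forall>k\<in>B. ?bas i k \<longrightarrow> v i \<le> v k + ?c i k) \<and> _ i)")
proof (cases "v \<in> topspace (Euclidean_space n)")
  case False
  then show ?thesis by (simp add: local_tropical_linear_space_def basis_cell_def)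
next
  case True
  let ?\<B> = "underlying_bases m n p" and ?u = "tilted_value p v"
  interpret valuated_matroid ?\<B> ?u
    using valuated_matroid.tilted[OF pluecker_valuated_matroid[OF tp]] .
  have tilt: "?u (insert i B - {k}) = ?u B + (v k + ?c i k - v i)"
    if "i \<notin> B" "k \<in> B" for i k
    using that finite_basis[OF B] by (simp add: sum_diff1)
  have minB: "(\<forall>A\<in>?\<B>. ?u B \<le> ?u A) \<longleftrightarrow>
      (\<forall>i\<in>{..<n} - B. \<forall>k\<in>B. ?bas i k \<longrightarrow> ?u B \<le> ?u (insert i B - {k}))"
  proof
    assume loc: "\<forall>i\<in>{..<n} - B. \<forall>k\<in>B. ?bas i k \<longrightarrow> ?u B \<le> ?u (insert i B - {k})"
    show "\<forall>A\<in>?\<B>. ?u B \<le> ?u A"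
    proof (rule ballI, rule local_min_imp_global_min[OF B])
      fix i k assume "i \<notin> B" "k \<in> B" and bas: "?bas i k"
      then have "i \<in> insert i B - {k}" by blast
      with bas have "i < n" by (auto simp: underlying_bases_def)
      with \<open>i \<notin> B\<close> \<open>k \<in> B\<close> bas loc show "?u B \<le> ?u (insert i B - {k})" by blast
    qed
  qed blast
  have "v \<in> local_tropical_linear_space m n p B \<longleftrightarrow>
      (\<forall>A\<in>?\<B>. ?u B \<le> ?u A) \<and> (\<forall>A\<in>?\<B>. \<forall>i\<in>{..<n} - A. \<exists>j\<in>A. insert i A - {j} \<in> ?\<B>
       \<and> ?u (insert i A - {j}) \<le> ?u A)"
    using True unfolding local_tropical_linear_space_def basis_cell_def
    by (simp add: max_weight_bases_iff[OF tp B] mem_tropical_linear_space_iff[OF tp True])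
  also have "\<dots> \<longleftrightarrow> (\<forall>A\<in>?\<B>. ?u B \<le> ?u A) \<and>
      (\<forall>i\<in>{..<n} - B. \<exists>k\<in>B. ?bas i k \<and> ?u (insert i B - {k}) \<le> ?u B)"
    by (rule conj_cong[OF refl no_unique_circuit_min_iff[OF B]]) blast
  also have "\<dots> \<longleftrightarrow>
    (\<forall>i\<in>{..<n} - B. (\<forall>k\<in>B. ?bas i k \<longrightarrow> ?u B \<le> ?u (insert i B - {k})) \<and>
       (\<exists>k\<in>B. ?bas i k \<and> ?u (insert i B - {k}) \<le> ?u B))"
    unfolding minB by blast
  also have "\<dots> \<longleftrightarrow>
    (\<forall>i\<in>{..<n} - B. (\<forall>k\<in>B. ?bas i k \<longrightarrow> v i \<le> v k + ?c i k) \<and>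
       (\<exists>k\<in>B. ?bas i k \<and> v k + ?c i k \<le> v i))"
  proof (rule ball_cong[OF refl])
    fix i assume i: "i \<in> {..<n} - B"
    have "?u B \<le> ?u (insert i B - {k}) \<longleftrightarrow> v i \<le> v k + ?c i k"
      "?u (insert i B - {k}) \<le> ?u B \<longleftrightarrow> v k + ?c i k \<le> v i" if "k \<in> B" for k
      using tilt[of i k] that i by auto
    then show "((\<forall>k\<in>B. ?bas i k \<longrightarrow> ?u B \<le> ?u (insert i B - {k})) \<and>
       (\<exists>k\<in>B. ?bas i k \<and> ?u (insert i B - {k}) \<le> ?u B)) \<longleftrightarrow>
      ((\<forall>k\<in>B. ?bas i k \<longrightarrow> v i \<le> v k + ?c i k) \<and> (\<exists>k\<in>B. ?bas i k \<and> v k + ?c i k \<le> v i))"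
      by (simp cong: ball_cong bex_cong)
  qed
  finally show ?thesis using True by simp
qed

section \<open>Graphs of tropically linear maps\<close>

lemma eq_Min_image_iff:
  fixes f :: "'a \<Rightarrow> 'b::linorder"
  assumes "finite J" "J \<noteq> {}"
  shows "y = Min (f ` J) \<longleftrightarrow> (\<forall>j\<in>J. y \<le> f j) \<and> (\<exists>j\<in>J. f j \<le> y)"
  using Min_ge_iff[of "f ` J" y] Min_le_iff[of "f ` J" y] assms by (simp add: order_eq_iff[of y])

text \<open>
  All polyhedra that occur below are of this kind, because an affine function under a
  tropically linear minimum is a coordinate plus a constant.
\<close>

lemma polyhedron_in_difference_constraints:
  assumes "finite T" "\<And>r s c. (r, s, c) \<in> T \<Longrightarrow> r < k \<and> s < k"
  shows "polyhedron_in k {x \<in> topspace (Euclidean_space k). \<forall>(r, s, c)\<in>T. x r \<le> x s + c}"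
proof -
  define F :: "((nat \<Rightarrow> real) \<times> real) set" where
    "F = (\<lambda>(r, s, c). (\<lambda>i. of_bool (i = r) - of_bool (i = s), c)) ` T"
  have eq: "(\<Sum>i<k. (of_bool (i = r) - of_bool (i = s)) * x i) = x r - x s"
    if "r < k" "s < k" for r s and x :: "nat \<Rightarrow> real"
    using that by (simp add: left_diff_distrib sum_subtractf of_bool_def if_distrib[of "\<lambda>a. a * _"]
        sum.delta cong: if_cong)
  have "(\<forall>(a, c)\<in>F. (\<Sum>i<k. a i * x i) \<le> c) \<longleftrightarrow> (\<forall>(r, s, c)\<in>T. x r \<le> x s + c)" for x
  proof -
    have "(\<forall>(a, c)\<in>F. (\<Sum>i<k. a i * x i) \<le> c) \<longleftrightarrow>
        (\<forall>(r, s, c)\<in>T. (\<Sum>i<k. (of_bool (i = r) - of_bool (i = s)) * x i) \<le> c)"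
      unfolding F_def by fastforce
    also have "\<dots> \<longleftrightarrow> (\<forall>(r, s, c)\<in>T. x r \<le> x s + c)"
      by (rule ball_cong[OF refl]) (auto dest: assms(2) simp: eq)
    finally show ?thesis .
  qed
  moreover have "finite F" using assms(1) by (simp add: F_def)
  ultimately show ?thesis unfolding polyhedron_in_def by (intro exI[of _ F]) auto
qed

lemma continuous_map_Min:
  fixes f :: "'i \<Rightarrow> 'a \<Rightarrow> real"
  assumes "finite J" "J \<noteq> {}" "\<And>j. j \<in> J \<Longrightarrow> continuous_map X euclideanreal (f j)"
  shows "continuous_map X euclideanreal (\<lambda>x. Min ((\<lambda>j. f j x) ` J))"
  using assms by (induction rule: finite_ne_induct) (auto intro!: continuous_map_real_min)

lemma continuous_map_Euclidean_coordinate: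
  "continuous_map (subtopology (Euclidean_space k) X) euclideanreal (\<lambda>x. x i)"
  unfolding Euclidean_space_def
  by (intro continuous_map_from_subtopology continuous_map_product_projection) simp

text \<open>
  A point of the graph is determined by its coordinates in \<open>B\<close>, so forgetting the others inverts
  \<open>f\<close>. The polyhedra on both sides are indexed by the functions \<open>\<phi>\<close> that select for every
  \<open>i \<notin> B\<close> an element of \<open>J i\<close>: on the piece of \<open>\<phi>\<close>, the minimum for \<open>i\<close> is attained at \<open>\<phi> i\<close>.
\<close>

lemma piecewise_linear_homeomorphism_min_graph:
  fixes J :: "nat \<Rightarrow> nat set" and c :: "nat \<Rightarrow> nat \<Rightarrow> real" and b :: "nat \<Rightarrow> nat"
  assumes b: "bij_betw b {..<m} B" and B: "B \<subseteq> {..<n}"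
    and J: "\<And>i. i \<in> {..<n} - B \<Longrightarrow> J i \<subseteq> {..<m} \<and> J i \<noteq> {}"
    and f_def: "f = (\<lambda>x i. if i \<in> B then x (the_inv_into {..<m} b i)
      else if i < n then Min ((\<lambda>j. x j + c i j) ` J i) else 0)"
    and Y_def: "Y = {v \<in> topspace (Euclidean_space n).
      \<forall>i\<in>{..<n} - B. v i = Min ((\<lambda>j. v (b j) + c i j) ` J i)}"
  shows "piecewise_linear_homeomorphism m n (topspace (Euclidean_space m)) Y f"
proof -
  define I where "I = {..<n} - B"
  define h where "h = the_inv_into {..<m} b"
  define g where "g = (\<lambda>(v :: nat \<Rightarrow> real) j. if j < m then v (b j) else 0)"
  have J: "J i \<subseteq> {..<m}" "J i \<noteq> {}" "finite (J i)" if "i \<in> I" for i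
    using J that finite_subset[of "J i" "{..<m}"] by (auto simp: I_def)
  have inj: "inj_on b {..<m}" and img: "b ` {..<m} = B" using b by (auto simp: bij_betw_def)
  have hb: "h (b j) = j" if "j < m" for j
    using that inj by (simp add: h_def the_inv_into_f_f)
  have h: "h i < m" "b (h i) = i" if "i \<in> B" for i
    using that img hb by (auto simp: h_def)
  have bj: "b j \<in> B" "b j < n" if "j < m" for j using img B that by auto
  have f: "f x i = (if i \<in> B then x (h i) else if i < n then Min ((\<lambda>j. x j + c i j) ` J i) else 0)"
    for x i by (simp add: f_def h_def)
  have fb: "f x (b j) = x j" if "j < m" for x j using that bj hb by (simp add: f)
  have fY: "f x \<in> Y" for x
  proof -
    have "(\<lambda>j. f x (b j) + c i j) ` J i = (\<lambda>j. x j + c i j) ` J i" if "i \<in> I" for i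
      using J(1)[OF that] fb by (intro image_cong) auto
    then show ?thesis using B by (auto simp: Y_def f topspace_Euclidean_space I_def)
  qed
  have gE: "g v \<in> topspace (Euclidean_space m)" for v by (simp add: g_def topspace_Euclidean_space)
  have gf: "g (f x) = x" if "x \<in> topspace (Euclidean_space m)" for x
    using that fb by (auto simp: g_def topspace_Euclidean_space fun_eq_iff)
  have fg: "f (g v) = v" if v: "v \<in> Y" for v
  proof
    fix i
    have "(\<lambda>j. g v j + c i j) ` J i = (\<lambda>j. v (b j) + c i j) ` J i" if "i \<in> I"
      using J(1)[OF that] by (intro image_cong) (auto simp: g_def)
    then show "f (g v) i = v i"
      using v h by (auto simp: f g_def Y_def I_def topspace_Euclidean_space)
  qed
  have YE: "Y \<subseteq> topspace (Euclidean_space n)" by (auto simp: Y_def)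
  have cf: "continuous_map (Euclidean_space m) (Euclidean_space n) f"
  proof -
    have "continuous_map (Euclidean_space m) euclideanreal (\<lambda>x. f x i)" for i
      using continuous_map_Euclidean_coordinate[of m "topspace (Euclidean_space m)"] J
      by (auto simp: f I_def intro!: continuous_map_Min continuous_map_add)
    then show ?thesis
      using fY YE
      by (subst (2) Euclidean_space_def)
        (auto simp: continuous_map_in_subtopology continuous_map_componentwise_UNIV
          topspace_Euclidean_space)
  qed
  have cg: "continuous_map (subtopology (Euclidean_space n) Y) (Euclidean_space m) g"
  proof -
    have "continuous_map (subtopology (Euclidean_space n) Y) euclideanreal (\<lambda>x. g x i)" for i
      by (auto simp: g_def intro: continuous_map_Euclidean_coordinate)
    then show ?thesis
      using gE
      by (subst (2) Euclidean_space_def)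
        (auto simp: continuous_map_in_subtopology continuous_map_componentwise_UNIV
          topspace_Euclidean_space)
  qed
  have homeo: "homeomorphic_maps (subtopology (Euclidean_space m) (topspace (Euclidean_space m)))
      (subtopology (Euclidean_space n) Y) f g"
    unfolding homeomorphic_maps_def
    using cf cg fY gf fg YE by (auto simp: continuous_map_in_subtopology)
  define \<Phi> where "\<Phi> = Pi\<^sub>E I J"
  have fin\<Phi>: "finite \<Phi>" unfolding \<Phi>_def using J(3) by (intro finite_PiE) (auto simp: I_def)
  have \<Phi>: "\<phi> i \<in> J i" if "\<phi> \<in> \<Phi>" "i \<in> I" for \<phi> i using that by (auto simp: \<Phi>_def)
  have choice: "\<exists>\<phi>\<in>\<Phi>. \<forall>i\<in>I. Q i (\<phi> i)" if Q: "\<forall>i\<in>I. \<exists>j\<in>J i. Q i j" for Q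
  proof -
    from bchoice[of I "\<lambda>i j. j \<in> J i \<and> Q i j"] Q
    obtain \<phi> where "\<forall>i\<in>I. \<phi> i \<in> J i \<and> Q i (\<phi> i)" by blast
    then show ?thesis by (intro bexI[of _ "restrict \<phi> I"]) (auto simp: \<Phi>_def)
  qed
  have finI: "finite I" by (simp add: I_def)
  have plf: "piecewise_linear_on m n (topspace (Euclidean_space m)) f"
  proof -
    \<comment> \<open>The term of \<open>\<phi> i\<close> is a lower bound for all terms of the minimum for \<open>i\<close>.\<close>
    define T where "T = (\<lambda>\<phi>. (\<lambda>(i, j). (\<phi> i, j, c i j - c i (\<phi> i))) ` (SIGMA i:I. J i))"
    define P where "P = (\<lambda>\<phi>. {x \<in> topspace (Euclidean_space m). \<forall>(r, s, d)\<in>T \<phi>. x r \<le> x s + d})"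
    have P: "x \<in> P \<phi> \<longleftrightarrow> x \<in> topspace (Euclidean_space m) \<and>
        (\<forall>i\<in>I. \<forall>j\<in>J i. x (\<phi> i) + c i (\<phi> i) \<le> x j + c i j)" for x \<phi>
    proof -
      have "x r \<le> x s + (d - e) \<longleftrightarrow> x r + e \<le> x s + d" for r s d e by linarith
      then show ?thesis by (simp add: P_def T_def split_paired_Ball_Sigma)
    qed
    have "polyhedron_in m (P \<phi>)" if "\<phi> \<in> \<Phi>" for \<phi>
      unfolding P_def
    proof (rule polyhedron_in_difference_constraints)
      show "finite (T \<phi>)" unfolding T_def using finI J(3) by (intro finite_imageI finite_SigmaI) auto
      show "r < m \<and> s < m" if "(r, s, d) \<in> T \<phi>" for r s d
        using that \<Phi>[OF \<open>\<phi> \<in> \<Phi>\<close>] J(1) by (fastforce simp: T_def)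
    qed
    moreover have "affine_map_on m n (P \<phi>) f" if \<phi>: "\<phi> \<in> \<Phi>" for \<phi>
      unfolding affine_map_on_def
    proof (intro exI ballI allI impI)
      \<comment> \<open>On this piece, coordinate \<open>i\<close> of \<open>f x\<close> is the single coordinate \<open>?s i\<close> of \<open>x\<close> plus a
        constant.\<close>
      let ?s = "\<lambda>i. if i \<in> B then h i else \<phi> i"
      fix x i assume x: "x \<in> P \<phi>" and i: "i < n"
      have s: "?s i < m" using i h \<Phi>[OF \<phi>, of i] J(1)[of i] by (auto simp: I_def)
      have "f x i = x (?s i) + (if i \<in> B then 0 else c i (\<phi> i))"
      proof (cases "i \<in> B")
        case True
        then show ?thesis by (simp add: f)
      next
        case False
        then have iI: "i \<in> I" using i by (simp add: I_def)
        have "x (\<phi> i) + c i (\<phi> i) = Min ((\<lambda>j. x j + c i j) ` J i)"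
          using x iI \<Phi>[OF \<phi> iI] J[OF iI] by (subst eq_Min_image_iff) (auto simp: P)
        then show ?thesis using False i by (simp add: f)
      qed
      also have "x (?s i) = (\<Sum>j<m. of_bool (j = ?s i) * x j)"
        using s by (simp add: of_bool_def if_distrib[of "\<lambda>a. a * _"] sum.delta cong: if_cong)
      finally show "f x i = (\<Sum>j<m. of_bool (j = ?s i) * x j) + (if i \<in> B then 0 else c i (\<phi> i))" .
    qed
    moreover have "\<Union> (P ` \<Phi>) = topspace (Euclidean_space m)"
    proof (intro equalityI subsetI)
      fix x assume x: "x \<in> topspace (Euclidean_space m)"
      have "\<forall>i\<in>I. \<exists>k\<in>J i. \<forall>j\<in>J i. x k + c i k \<le> x j + c i j"
      proof
        fix i assume i: "i \<in> I"
        let ?M = "Min ((\<lambda>j. x j + c i j) ` J i)"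
        have M: "(\<forall>j\<in>J i. ?M \<le> x j + c i j) \<and> (\<exists>k\<in>J i. x k + c i k \<le> ?M)"
          using iffD1[OF eq_Min_image_iff[OF J(3,2)[OF i]] refl] .
        then obtain k where k: "k \<in> J i" "x k + c i k \<le> ?M" by blast
        have "x k + c i k \<le> x j + c i j" if "j \<in> J i" for j
          by (rule order_trans[OF k(2)]) (use M that in blast)
        with k(1) show "\<exists>k\<in>J i. \<forall>j\<in>J i. x k + c i k \<le> x j + c i j" by blast
      qed
      from choice[OF this] obtain \<phi> where "\<phi> \<in> \<Phi>"
          "\<forall>i\<in>I. \<forall>j\<in>J i. x (\<phi> i) + c i (\<phi> i) \<le> x j + c i j" by blast
      with x show "x \<in> \<Union> (P ` \<Phi>)" by (intro UN_I[of \<phi>]) (simp_all add: P)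
    qed (auto simp: P)
    ultimately show ?thesis
      unfolding piecewise_linear_on_def using fin\<Phi> by (intro exI[of _ "P ` \<Phi>"]) auto
  qed
  have plg: "piecewise_linear_on n m Y g"
  proof -
    \<comment> \<open>Here \<open>v i\<close> is a lower bound for all terms of its minimum, and the term of \<open>\<phi> i\<close>
      is at most \<open>v i\<close>.\<close>
    define T where "T = (\<lambda>\<phi>. (\<lambda>(i, j). (i, b j, c i j)) ` (SIGMA i:I. J i)
      \<union> (\<lambda>i. (b (\<phi> i), i, - c i (\<phi> i))) ` I)"
    define P where "P = (\<lambda>\<phi>. {v \<in> topspace (Euclidean_space n). \<forall>(r, s, d)\<in>T \<phi>. v r \<le> v s + d})"
    have P: "v \<in> P \<phi> \<longleftrightarrow> v \<in> topspace (Euclidean_space n) \<and>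
        (\<forall>i\<in>I. (\<forall>j\<in>J i. v i \<le> v (b j) + c i j) \<and> v (b (\<phi> i)) + c i (\<phi> i) \<le> v i)" for v \<phi>
      unfolding P_def T_def by (auto simp: ball_Un algebra_simps)
    have Y: "v \<in> Y \<longleftrightarrow> v \<in> topspace (Euclidean_space n) \<and>
        (\<forall>i\<in>I. (\<forall>j\<in>J i. v i \<le> v (b j) + c i j) \<and> (\<exists>j\<in>J i. v (b j) + c i j \<le> v i))" for v
      unfolding Y_def I_def[symmetric] mem_Collect_eq
      by (intro conj_cong ball_cong eq_Min_image_iff J refl)
    have "polyhedron_in n (P \<phi>)" if "\<phi> \<in> \<Phi>" for \<phi>
      unfolding P_def
    proof (rule polyhedron_in_difference_constraints)
      show "finite (T \<phi>)" unfolding T_def using finI J(3)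
        by (intro finite_UnI finite_imageI finite_SigmaI) auto
      show "r < n \<and> s < n" if "(r, s, d) \<in> T \<phi>" for r s d
        using that \<Phi>[OF \<open>\<phi> \<in> \<Phi>\<close>] J(1) bj(2) by (fastforce simp: T_def I_def)
    qed
    moreover have "affine_map_on n m (P \<phi>) g" for \<phi>
      unfolding affine_map_on_def
    proof (intro exI ballI allI impI)
      fix v j assume j: "j < m"
      then show "g v j = (\<Sum>i<n. of_bool (i = b j) * v i) + 0"
        using bj by (simp add: g_def of_bool_def if_distrib[of "\<lambda>a. a * _"] sum.delta cong: if_cong)
    qed
    moreover have "\<Union> (P ` \<Phi>) = Y"
    proof (intro equalityI subsetI)
      fix v assume v: "v \<in> Y"
      then have "\<forall>i\<in>I. \<exists>j\<in>J i. v (b j) + c i j \<le> v i" by (simp add: Y)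
      from choice[OF this] obtain \<phi> where "\<phi> \<in> \<Phi>"
          "\<forall>i\<in>I. v (b (\<phi> i)) + c i (\<phi> i) \<le> v i" by blast
      with v show "v \<in> \<Union> (P ` \<Phi>)" by (intro UN_I[of \<phi>]) (simp_all add: P Y)
    next
      fix v assume "v \<in> \<Union> (P ` \<Phi>)"
      then obtain \<phi> where "\<phi> \<in> \<Phi>" "v \<in> P \<phi>" by blast
      then show "v \<in> Y" using \<Phi> by (auto simp: P Y)
    qed
    ultimately show ?thesis
      unfolding piecewise_linear_on_def using fin\<Phi> by (intro exI[of _ "P ` \<Phi>"]) auto
  qed
  from homeo plf plg YE show ?thesis unfolding piecewise_linear_homeomorphism_def by blast
qed

section \<open>Local tropical linear spaces\<close>

text \<open>
  This makes the minimum that defines \<open>f\<^sub>B\<close> range over a nonempty set.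
\<close>

lemma loopless_exchange:
  assumes vm: "valuated_matroid \<B> w" and "loopless n \<B>" and B: "B \<in> \<B>" and i: "i < n" "i \<notin> B"
  shows "\<exists>k\<in>B. insert i B - {k} \<in> \<B>"
proof -
  from assms obtain A where "A \<in> \<B>" "i \<in> A" unfolding loopless_def matroid_indep_def by blast
  with valuated_matroid.exchange[OF vm _ B, of A i] i show ?thesis by blast
qed

theorem theorem2p6:
  fixes m n :: nat and p :: "nat set \<Rightarrow> ereal" and B :: "nat set"
  assumes "tropical_pluecker m n p"
    and "loopless n (underlying_bases m n p)"
    and "B \<in> underlying_bases m n p"
  shows "subtopology (Euclidean_space n) (local_tropical_linear_space m n p B)
           homeomorphic_space Euclidean_space m
       \<and> (\<forall>b. bij_betw b {..<m} B \<longrightarrow>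
            piecewise_linear_homeomorphism m n
              (topspace (Euclidean_space m)) (local_tropical_linear_space m n p B)
              (local_param m n p B b))"
proof -
  let ?\<B> = "underlying_bases m n p" and ?L = "local_tropical_linear_space m n p B"
  note vm = pluecker_valuated_matroid[OF assms(1)]
  have B: "B \<subseteq> {..<n}" "card B = m" "finite B"
    using assms(3) finite_subset by (auto simp: underlying_bases_def)
  have main: "piecewise_linear_homeomorphism m n (topspace (Euclidean_space m)) ?L
      (local_param m n p B b)" if b: "bij_betw b {..<m} B" for b
  proof -
    define J where "J = (\<lambda>i. {j. j < m \<and> insert i B - {b j} \<in> ?\<B>})"
    define c where "c = (\<lambda>i j. real_of_ereal (p (insert i B - {b j})) - real_of_ereal (p B))"
    have img: "b ` {..<m} = B" using b by (simp add: bij_betw_def)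
    have J: "J i \<subseteq> {..<m} \<and> J i \<noteq> {}" if "i \<in> {..<n} - B" for i
      using loopless_exchange[OF vm assms(2,3), of i] that img by (auto simp: J_def)
    have circ: "{j. j < m \<and> b j \<in> fundamental_circuit n ?\<B> i B \<and> b j \<noteq> i} = J i"
      if "i < n" "i \<notin> B" for i
    proof -
      have "b j \<in> B" if "j < m" for j using img that by blast
      then show ?thesis
        using that(2) unfolding fundamental_circuit_eq[OF vm assms(3) B(1) that] J_def by blast
    qed
    show ?thesis
    proof (rule piecewise_linear_homeomorphism_min_graph[OF b B(1) J, where c = c])
      show "local_param m n p B b = (\<lambda>x i. if i \<in> B then x (the_inv_into {..<m} b i)
          else if i < n then Min ((\<lambda>j. x j + c i j) ` J i) else 0)"
        unfolding local_param_def by (intro ext) (simp add: circ c_def add_diff_eq)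
      show "?L = {v \<in> topspace (Euclidean_space n).
          \<forall>i\<in>{..<n} - B. v i = Min ((\<lambda>j. v (b j) + c i j) ` J i)}" (is "_ = ?R")
      proof (rule set_eqI)
        fix v
        have graph: "v i = Min ((\<lambda>j. v (b j) + c i j) ` J i) \<longleftrightarrow>
            (\<forall>k\<in>B. insert i B - {k} \<in> ?\<B> \<longrightarrow>
               v i \<le> v k + (real_of_ereal (p (insert i B - {k})) - real_of_ereal (p B))) \<and>
            (\<exists>k\<in>B. insert i B - {k} \<in> ?\<B> \<and>
               v k + (real_of_ereal (p (insert i B - {k})) - real_of_ereal (p B)) \<le> v i)"
          if "i \<in> {..<n} - B" for i
        proof -
          have fin: "finite (J i)" by (simp add: J_def)
          have ball: "(\<forall>k\<in>B. Q k) \<longleftrightarrow> (\<forall>j<m. Q (b j))" and bex: "(\<exists>k\<in>B. Q k) \<longleftrightarrow> (\<exists>j<m. Q (b j))" for Q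
            unfolding img[symmetric] by blast+
          show ?thesis
            unfolding eq_Min_image_iff[OF fin conjunct2[OF J[OF that]]] ball bex
            unfolding J_def c_def by blast
        qed
        show "v \<in> ?L \<longleftrightarrow> v \<in> ?R"
          unfolding local_tropical_linear_space_iff[OF assms(1,3)] mem_Collect_eq
          by (intro conj_cong ball_cong refl) (rule graph[symmetric])
      qed
    qed
  qed
  obtain b where b: "bij_betw b {..<m} B"
    using ex_bij_betw_nat_finite[OF B(3)] B(2) by (auto simp: atLeast0LessThan)
  obtain g where "homeomorphic_maps (Euclidean_space m) (subtopology (Euclidean_space n) ?L)
      (local_param m n p B b) g"
    using main[OF b] unfolding piecewise_linear_homeomorphism_def subtopology_topspace by blast
  then have "Euclidean_space m homeomorphic_space subtopology (Euclidean_space n) ?L"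
    by (rule homeomorphic_maps_imp_homeomorphic_space)
  with main show ?thesis using homeomorphic_space_sym by blast
qed

end
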